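(* Let $\alpha_0>-1$, $c_1,c_2>0$, $c_1\neq c_2$, and let $n_1,n_2\ge1$ be integers. Let $L^{(1)}_{(n_1,n_2)},L^{(2)}_{(n_1,n_2)}$ be the Laguerre II multiple orthogonal polynomials of type I (for the weights $\omega_a(x)=e^{-c_ax}x^{\alpha_0}$, $a\in\{1,2\}$, and Lebesgue measure on $[0,\infty)$) biorthogonal to the monic Laguerre II polynomials of type II. Then, for $a\in\{1,2\}$, $$L^{(a)}_{(n_1,n_2)}(x)=K_a\;F^{2:0;0}_{1:1;0}\left[{(-n_a+1,\alpha_0+1):--;--\atop(-n_1-n_2+2):(\alpha_0+1);--}\Bigg|\frac{(c_a-\hat c_a)c_a}{\hat c_a}x,\frac{\hat c_a-c_a}{\hat c_a}\right]$$ $$=K_a\sum_{l=0}^{n_a-1}\sum_{m=0}^{n_a-1-l}\frac{(-n_a+1)_{l+m}\,(\alpha_0+1)_{l+m}}{l!\,m!\,(-n_1-n_2+2)_{l+m}\,(\alpha_0+1)_l}\left(\frac{(c_a-\hat c_a)c_a}{\hat c_a}\right)^l\left(\frac{\hat c_a-c_a}{\hat c_a}\right)^mx^l,$$ where $$K_a=\frac{(-1)^{n_a-1}(n_1+n_2-2)!}{(n_1-1)!\,(n_2-1)!\,\Gamma(\alpha_0+n_1+n_2)}\,c_a^{\alpha_0+1}\left(\frac{c_a\hat c_a}{\hat c_a-c_a}\right)^{n_1+n_2-1}.$$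
   Context: Pochhammer symbol: $(x)_0=1$, $(x)_n=x(x+1)\cdots(x+n-1)$. Notation: $\hat c_1=c_2$, $\hat c_2=c_1$. The type II polynomial $L_{(m_1,m_2)}$, $m_1,m_2\ge0$, is the unique monic polynomial of degree $m_1+m_2$ with $\int_0^\infty x^jL_{(m_1,m_2)}(x)\,\omega_a(x)\,dx=0$ for $j\in\{0,\dots,m_a-1\}$, $a\in\{1,2\}$. The type I polynomials biorthogonal to them are the unique pair with $\deg L^{(a)}_{(n_1,n_2)}\le n_a-1$ such that $$\int_0^\infty x^j\big(L^{(1)}_{(n_1,n_2)}(x)\omega_1(x)+L^{(2)}_{(n_1,n_2)}(x)\omega_2(x)\big)\,dx=0,\quad j\in\{0,\dots,n_1+n_2-2\},$$ and $$\int_0^\infty L_{(m_1,m_2)}(x)\big(L^{(1)}_{(n_1,n_2)}(x)\omega_1(x)+L^{(2)}_{(n_1,n_2)}(x)\omega_2(x)\big)\,dx=1\quad\text{whenever }m_1+m_2=n_1+n_2-1$$ (equivalently, since $L_{(m_1,m_2)}$ is monic, the integral with $x^{n_1+n_2-1}$ in place of $L_{(m_1,m_2)}(x)$ equals $1$). Kampé de Fériet series: $$F^{p:r;s}_{q:n;t}\left[{(a_i):(b_i);(d_i)\atop(\alpha_i):(\beta_i);(\gamma_i)}\Bigg|x,y\right]=\sum_{l,m\ge0}\frac{\prod_i(a_i)_{l+m}}{\prod_i(\alpha_i)_{l+m}}\frac{\prod_i(b_i)_l}{\prod_i(\beta_i)_l}\frac{\prod_i(d_i)_m}{\prod_i(\gamma_i)_m}\frac{x^l}{l!}\frac{y^m}{m!},$$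 "$--$" denoting an empty list; here the parameter $-n_a+1$ makes the sum finite, over $l+m\le n_a-1$. *)

theory Defs
  imports "HOL-Analysis.Analysis" "HOL-Computational_Algebra.Polynomial"
begin

text \<open>
  Families indexed by \<open>a \<in> {1, 2}\<close> (the parameters \<open>c\<close>, the multi-indices \<open>m\<close>, \<open>n\<close>) are
  functions on \<open>nat\<close>; only their values at \<open>1\<close> and \<open>2\<close> are ever used.
\<close>

definition hat :: "(nat \<Rightarrow> 'b) \<Rightarrow> nat \<Rightarrow> 'b" where
  "hat c a = (if a = 1 then c 2 else c 1)"

definition weight :: "real \<Rightarrow> (nat \<Rightarrow> real) \<Rightarrow> nat \<Rightarrow> real \<Rightarrow> real" where
  "weight \<alpha>0 c a x = exp (- c a * x) * x powr \<alpha>0"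

definition is_laguerre2_typeII ::
  "real \<Rightarrow> (nat \<Rightarrow> real) \<Rightarrow> (nat \<Rightarrow> nat) \<Rightarrow> real poly \<Rightarrow> bool" where
  "is_laguerre2_typeII \<alpha>0 c m L \<longleftrightarrow>
     lead_coeff L = 1 \<and> degree L = m 1 + m 2 \<and>
     (\<forall>a\<in>{1, 2}. \<forall>j<m a.
        (LBINT x:{0..}. x ^ j * poly L x * weight \<alpha>0 c a x) = 0)"

definition laguerre2_typeII ::
  "real \<Rightarrow> (nat \<Rightarrow> real) \<Rightarrow> (nat \<Rightarrow> nat) \<Rightarrow> real poly" where
  "laguerre2_typeII \<alpha>0 c m = (THE L. is_laguerre2_typeII \<alpha>0 c m L)"

text \<open>
  The bounds \<open>deg A\<^sub>a \<le> n\<^sub>a - 1\<close>, \<open>j \<le> n\<^sub>1 + n\<^sub>2 - 2\<close> and \<open>m\<^sub>1 + m\<^sub>2 = n\<^sub>1 + n\<^sub>2 - 1\<close> are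
  written without subtraction, which truncates on \<open>nat\<close>; the zero polynomial has degree
  \<open>-\<infinity>\<close> in the first one.
\<close>

definition is_laguerre2_typeI ::
  "real \<Rightarrow> (nat \<Rightarrow> real) \<Rightarrow> (nat \<Rightarrow> nat) \<Rightarrow> real poly \<Rightarrow> real poly \<Rightarrow> bool" where
  "is_laguerre2_typeI \<alpha>0 c n A1 A2 \<longleftrightarrow>
     (A1 = 0 \<or> degree A1 < n 1) \<and> (A2 = 0 \<or> degree A2 < n 2) \<and>
     (\<forall>j. j + 2 \<le> n 1 + n 2 \<longrightarrow>
        (LBINT x:{0..}. x ^ j *
           (poly A1 x * weight \<alpha>0 c 1 x + poly A2 x * weight \<alpha>0 c 2 x)) = 0) \<and>
     (\<forall>m. m 1 + m 2 + 1 = n 1 + n 2 \<longrightarrow>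
        (LBINT x:{0..}. poly (laguerre2_typeII \<alpha>0 c m) x *
           (poly A1 x * weight \<alpha>0 c 1 x + poly A2 x * weight \<alpha>0 c 2 x)) = 1)"

definition laguerre2_typeI ::
  "real \<Rightarrow> (nat \<Rightarrow> real) \<Rightarrow> (nat \<Rightarrow> nat) \<Rightarrow> nat \<Rightarrow> real poly" where
  "laguerre2_typeI \<alpha>0 c n a =
     (let A = (THE A. is_laguerre2_typeI \<alpha>0 c n (fst A) (snd A))
      in if a = 1 then fst A else snd A)"

text \<open>
  Rows of parameters are lists. For a terminating series, a term with a vanishing
  denominator Pochhammer symbol beyond the termination index has vanishing numerator and
  contributes \<open>0 / 0 = 0\<close>.
\<close>

definition pochs :: "real list \<Rightarrow> nat \<Rightarrow> real" where
  "pochs as k = (\<Prod>u\<leftarrow>as. pochhammer u k)"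

definition kampe_de_feriet ::
  "real list \<Rightarrow> real list \<Rightarrow> real list \<Rightarrow> real list \<Rightarrow> real list \<Rightarrow> real list \<Rightarrow>
   real \<Rightarrow> real \<Rightarrow> real" where
  "kampe_de_feriet as bs ds \<alpha>s \<beta>s \<gamma>s x y =
     (\<Sum>\<^sub>\<infinity>(l, m)\<in>UNIV.
        pochs as (l + m) / pochs \<alpha>s (l + m) *
        (pochs bs l / pochs \<beta>s l) * (pochs ds m / pochs \<gamma>s m) *
        (x ^ l / fact l) * (y ^ m / fact m))"

definition laguerre2_K :: "real \<Rightarrow> (nat \<Rightarrow> real) \<Rightarrow> (nat \<Rightarrow> nat) \<Rightarrow> nat \<Rightarrow> real" where
  "laguerre2_K \<alpha>0 c n a =
     (- 1) ^ (n a - 1) * fact (n 1 + n 2 - 2) /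
       (fact (n 1 - 1) * fact (n 2 - 1) * Gamma (\<alpha>0 + real (n 1) + real (n 2))) *
     c a powr (\<alpha>0 + 1) *
     (c a * hat c a / (hat c a - c a)) ^ (n 1 + n 2 - 1)"

end

(*
The moments of x^l e^(-c x) x^alpha are Gamma(alpha + 1 + j) times (alpha + 1 + j)_l c^(-j) up to a
constant, so with s = 1/c_1, t = 1/c_2 a type I form of index (n, m) amounts to polynomials P, Q of
degrees < n, < m in j such that P(j) s^j + Q(j) t^j vanishes for j < n + m - 1 and is prescribed at
j = n + m - 1. The sum of the residues of z^j / ((z - s)^n (z - t)^m) at s and t has exactly
this shape, and it is 0 for j < n + m - 1 and 1 for j = n + m - 1. The residue at s is a combination
of binomial coefficients (j choose i); Chu-Vandermonde rewrites these in terms of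
(alpha + 1 + j)_l, which yields the double sum. Uniqueness of the type I and existence and
uniqueness of the type II polynomials follow from the existence of these forms for all indices.
*)

theory Submission
  imports Defs "HOL-Computational_Algebra.Formal_Power_Series"
begin

section \<open>Moments of the weights and weighted integrals of polynomials\<close>

definition moment :: "real \<Rightarrow> real \<Rightarrow> nat \<Rightarrow> real" where
  "moment \<alpha> c k = Gamma (\<alpha> + 1 + real k) / c powr (\<alpha> + 1 + real k)"

lemma has_bochner_integral_Gamma:
  assumes "s > (0::real)"
  shows "has_bochner_integral lborel (\<lambda>t. indicator {0..} t * t powr (s - 1) / exp t) (Gamma s)"
proof (rule has_bochner_integral_nn_integral)
  show "(\<lambda>t. indicator {0..} t * t powr (s - 1) / exp t) \<in> borel_measurable lborel"
    by measurable
  show "AE t in lborel. 0 \<le> indicator {0..} t * t powr (s - 1) / exp t"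
    by simp
  show "0 \<le> Gamma s"
    using Gamma_real_pos[OF assms] by simp
  show "(\<integral>\<^sup>+t. ennreal (indicator {0..} t * t powr (s - 1) / exp t) \<partial>lborel) = ennreal (Gamma s)"
    using Gamma_conv_nn_integral_real[OF assms] by simp
qed

text \<open>The substitution \<open>t = c k * x\<close> reduces this to the Gamma integral with
  parameter \<open>\<alpha> + 1 + real j\<close>.\<close>

lemma has_bochner_integral_moment:
  assumes "\<alpha> > -1" and "c k > 0"
  shows "has_bochner_integral lborel (\<lambda>x. indicator {0..} x * (x ^ j * weight \<alpha> c k x))
           (moment \<alpha> (c k) j)"
proof -
  define s where "s = \<alpha> + 1 + real j"
  have s: "s > 0" using assms by (simp add: s_def)
  have "has_bochner_integral lborel
          (\<lambda>x. indicator {0..} (0 + c k * x) * (0 + c k * x) powr (s - 1) / exp (0 + c k * x))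
          (Gamma s /\<^sub>R \<bar>c k\<bar>)"
    using has_bochner_integral_Gamma[OF s] assms
    by (subst lborel_has_bochner_integral_real_affine_iff[symmetric]) auto
  then have "has_bochner_integral lborel
          (\<lambda>x. (1 / c k powr (s - 1)) *
            (indicator {0..} (0 + c k * x) * (0 + c k * x) powr (s - 1) / exp (0 + c k * x)))
          ((1 / c k powr (s - 1)) * (Gamma s /\<^sub>R \<bar>c k\<bar>))"
    by (rule has_bochner_integral_mult_right)
  also have "(1 / c k powr (s - 1)) * (Gamma s /\<^sub>R \<bar>c k\<bar>) = moment \<alpha> (c k) j"
    using assms by (simp add: moment_def s_def powr_diff powr_add field_simps)
  also have "(\<lambda>x. (1 / c k powr (s - 1)) *
            (indicator {0..} (0 + c k * x) * (0 + c k * x) powr (s - 1) / exp (0 + c k * x))) =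
          (\<lambda>x. indicator {0..} x * (x ^ j * weight \<alpha> c k x))"
  proof
    fix x :: real
    consider "x < 0" | "x = 0" | "x > 0" by linarith
    then show "(1 / c k powr (s - 1)) *
            (indicator {0..} (0 + c k * x) * (0 + c k * x) powr (s - 1) / exp (0 + c k * x)) =
          indicator {0..} x * (x ^ j * weight \<alpha> c k x)"
    proof cases
      case 1
      then have "c k * x < 0" using assms by (simp add: mult_pos_neg)
      with 1 show ?thesis by simp
    next
      \<comment> \<open>\<open>0 powr r\<close> is \<open>0\<close> for every \<open>r\<close>, so
        both sides vanish at the origin even for a negative or zero exponent.\<close>
      case 2
      then show ?thesis by (simp add: weight_def)
    next
      case 3
      then show ?thesis using assms
        by (simp add: weight_def s_def powr_mult powr_add powr_realpow exp_minus field_simps)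
    qed
  qed
  finally show ?thesis .
qed

text \<open>Packages the integrals as linear functionals on \<open>real poly\<close>, the shape in
  which the abstract part below uses them.\<close>

definition wint :: "real \<Rightarrow> (nat \<Rightarrow> real) \<Rightarrow> nat \<Rightarrow> real poly \<Rightarrow> real" where
  "wint \<alpha> c k p = (LBINT x:{0..}. poly p x * weight \<alpha> c k x)"

lemma set_integrable_poly_weight:
  assumes "\<alpha> > -1" and "c k > 0"
  shows "set_integrable lborel {0..} (\<lambda>x. poly p x * weight \<alpha> c k x)"
proof -
  have "integrable lborel
          (\<lambda>x. \<Sum>j\<le>degree p. coeff p j * (indicator {0..} x * (x ^ j * weight \<alpha> c k x)))"
    using has_bochner_integral_moment[where c = c and k = k, OF assms]
    by (intro Bochner_Integration.integrable_sum integrable_mult_right)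
       (auto simp: has_bochner_integral_iff)
  then show ?thesis
    by (simp add: set_integrable_def poly_altdef sum_distrib_left sum_distrib_right mult_ac)
qed

lemma wint_add:
  assumes "\<alpha> > -1" and "c k > 0"
  shows "wint \<alpha> c k (p + q) = wint \<alpha> c k p + wint \<alpha> c k q"
  unfolding wint_def
  by (subst set_integral_add(2)[symmetric])
     (use assms in \<open>auto intro: set_integrable_poly_weight simp: algebra_simps\<close>)

lemma wint_smult: "wint \<alpha> c k (smult r p) = r * wint \<alpha> c k p"
  by (simp add: wint_def mult.assoc)

lemma wint_monom:
  assumes "\<alpha> > -1" and "c k > 0"
  shows "wint \<alpha> c k (monom r j) = r * moment \<alpha> (c k) j"
proof -
  have "wint \<alpha> c k (monom 1 j) = moment \<alpha> (c k) j"
    using has_bochner_integral_moment[where c = c and k = k and j = j, OF assms]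
    by (simp add: wint_def set_lebesgue_integral_def poly_monom has_bochner_integral_iff)
  then show ?thesis
    using wint_smult[of \<alpha> c k r "monom 1 j"] by (simp add: smult_monom)
qed

lemma LBINT_typeI:
  assumes "\<alpha> > -1" and "c 1 > 0" and "c 2 > 0"
  shows "(LBINT x:{0..}. poly p x * (poly A x * weight \<alpha> c 1 x + poly B x * weight \<alpha> c 2 x)) =
           wint \<alpha> c 1 (p * A) + wint \<alpha> c 2 (p * B)"
proof -
  have "(LBINT x:{0..}. poly (p * A) x * weight \<alpha> c 1 x + poly (p * B) x * weight \<alpha> c 2 x) =
          wint \<alpha> c 1 (p * A) + wint \<alpha> c 2 (p * B)"
    unfolding wint_def using assms
    by (intro set_integral_add(2) set_integrable_poly_weight)
  then show ?thesis by (simp add: algebra_simps)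
qed

section \<open>Abstract orthogonality: existence and uniqueness for every multi-index\<close>

lemma poly_as_sum_bound:
  fixes p :: "'a::comm_semiring_1 poly"
  assumes "\<And>i. i \<ge> n \<Longrightarrow> coeff p i = 0"
  shows "p = (\<Sum>i<n. smult (coeff p i) (monom 1 i))"
proof (rule poly_eqI)
  fix k
  show "coeff p k = coeff (\<Sum>i<n. smult (coeff p i) (monom 1 i)) k"
    using assms[of k]
    by (cases "k < n")
       (auto simp: coeff_sum if_distrib[of "\<lambda>x. _ * x"] sum.delta cong: if_cong)
qed

text \<open>
  \<open>\<phi>\<close> and \<open>\<psi>\<close> stand for integration against the two weights. Existence of type I forms for every
  multi-index already makes every multi-index normal: the leading coefficient of the form for
  \<open>(n + 1, m)\<close> cannot pair to zero with the type II polynomial for \<open>(n, m)\<close>, so the latter can be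
  used to correct a polynomial orthogonal for \<open>(n, m)\<close> to one orthogonal for \<open>(n + 1, m)\<close>.
\<close>

locale normal_pair =
  fixes \<phi> \<psi> :: "real poly \<Rightarrow> real"
  assumes \<phi>_add: "\<phi> (p + q) = \<phi> p + \<phi> q" and \<phi>_smult: "\<phi> (smult r p) = r * \<phi> p"
    and \<psi>_add: "\<psi> (p + q) = \<psi> p + \<psi> q" and \<psi>_smult: "\<psi> (smult r p) = r * \<psi> p"
    and typeI_ex: "0 < n + m \<Longrightarrow> \<exists>A B. (\<forall>i\<ge>n. coeff A i = 0) \<and> (\<forall>i\<ge>m. coeff B i = 0) \<and>
      (\<forall>j. Suc j \<le> n + m \<longrightarrow>
        \<phi> (monom 1 j * A) + \<psi> (monom 1 j * B) = (if Suc j = n + m then 1 else 0))"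
begin

text \<open>The integral of \<open>p\<close> against the type I linear form with polynomial
  coefficients \<open>A\<close> and \<open>B\<close>.\<close>

definition form :: "real poly \<Rightarrow> real poly \<Rightarrow> real poly \<Rightarrow> real" where
  "form A B p = \<phi> (p * A) + \<psi> (p * B)"

text \<open>Type II orthogonality alone, with no condition on degree or leading coefficient, so that
  it defines a linear space.\<close>

definition ortho :: "nat \<Rightarrow> nat \<Rightarrow> real poly \<Rightarrow> bool" where
  "ortho n m p \<longleftrightarrow> (\<forall>j<n. \<phi> (monom 1 j * p) = 0) \<and> (\<forall>j<m. \<psi> (monom 1 j * p) = 0)"

lemma \<phi>_0 [simp]: "\<phi> 0 = 0"
  using \<phi>_smult[of 0 0] by simp

lemma \<psi>_0 [simp]: "\<psi> 0 = 0"
  using \<psi>_smult[of 0 0] by simp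

lemma \<phi>_sum: "\<phi> (\<Sum>i\<in>I. f i) = (\<Sum>i\<in>I. \<phi> (f i))"
  by (induction I rule: infinite_finite_induct) (auto simp: \<phi>_add)

lemma \<psi>_sum: "\<psi> (\<Sum>i\<in>I. f i) = (\<Sum>i\<in>I. \<psi> (f i))"
  by (induction I rule: infinite_finite_induct) (auto simp: \<psi>_add)

text \<open>By linearity in \<open>A\<close>, only the pairings of \<open>p\<close> with powers
  below \<open>n\<close> enter, and these are the ones that \<open>ortho\<close> makes
  vanish.\<close>

lemma \<phi>_mult_eq_sum:
  assumes "\<And>i. i \<ge> n \<Longrightarrow> coeff A i = 0"
  shows "\<phi> (p * A) = (\<Sum>i<n. coeff A i * \<phi> (monom 1 i * p))"
  by (subst poly_as_sum_bound[OF assms])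
     (auto simp: \<phi>_sum \<phi>_smult sum_distrib_left mult.commute[of p])

lemma \<psi>_mult_eq_sum:
  assumes "\<And>i. i \<ge> n \<Longrightarrow> coeff A i = 0"
  shows "\<psi> (p * A) = (\<Sum>i<n. coeff A i * \<psi> (monom 1 i * p))"
  by (subst poly_as_sum_bound[OF assms])
     (auto simp: \<psi>_sum \<psi>_smult sum_distrib_left mult.commute[of p])

lemma form_eq_sum:
  assumes "\<And>i. i \<ge> n \<Longrightarrow> coeff p i = 0"
  shows "form A B p = (\<Sum>i<n. coeff p i * form A B (monom 1 i))"
  unfolding form_def
  by (subst mult.commute, subst \<phi>_mult_eq_sum[OF assms], assumption,
      subst mult.commute, subst \<psi>_mult_eq_sum[OF assms], assumption)
     (simp add: sum.distrib algebra_simps)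

lemma form_ortho:
  assumes "ortho n m p" and "\<And>i. i \<ge> n \<Longrightarrow> coeff A i = 0" and "\<And>i. i \<ge> m \<Longrightarrow> coeff B i = 0"
  shows "form A B p = 0"
  using assms(1) \<phi>_mult_eq_sum[OF assms(2), where p = p] \<psi>_mult_eq_sum[OF assms(3), where p = p]
  by (simp add: form_def ortho_def)

text \<open>All pairings but the one with the top power in \<open>A\<close> vanish. This ties the
  top coefficient of a type I polynomial to the first condition that \<open>p\<close> is not assumed
  to satisfy.\<close>

lemma form_ortho_Suc:
  assumes "ortho n m p" and "\<And>i. i \<ge> Suc n \<Longrightarrow> coeff A i = 0" and "\<And>i. i \<ge> m \<Longrightarrow> coeff B i = 0"
  shows "form A B p = coeff A n * \<phi> (monom 1 n * p)"
  using assms(1) \<phi>_mult_eq_sum[OF assms(2), where p = p] \<psi>_mult_eq_sum[OF assms(3), where p = p]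
  by (simp add: form_def ortho_def)

text \<open>Linearity in the tested polynomial turns the conditions on monomials into the extraction
  of one coefficient.\<close>

lemma typeIE:
  assumes "0 < n + m"
  obtains A B where "\<And>i. i \<ge> n \<Longrightarrow> coeff A i = 0" "\<And>i. i \<ge> m \<Longrightarrow> coeff B i = 0"
    "\<And>p. (\<And>i. i \<ge> n + m \<Longrightarrow> coeff p i = 0) \<Longrightarrow> form A B p = coeff p (n + m - 1)"
proof -
  obtain A B where AB: "\<forall>i\<ge>n. coeff A i = 0" "\<forall>i\<ge>m. coeff B i = 0"
    "\<forall>j. Suc j \<le> n + m \<longrightarrow> form A B (monom 1 j) = (if Suc j = n + m then 1 else 0)"
    using typeI_ex[OF assms] unfolding form_def by blast
  obtain N where N: "n + m = Suc N" using assms by (cases "n + m") auto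
  have "form A B p = coeff p (n + m - 1)" if "\<And>i. i \<ge> n + m \<Longrightarrow> coeff p i = 0" for p
    using form_eq_sum[OF that, where A = A and B = B] AB(3) by (simp add: N)
  with AB show thesis by (intro that) auto
qed

text \<open>The type I form for \<open>(Suc n, m)\<close> sends \<open>p\<close> to its top
  coefficient 1; by \<open>form_ortho_Suc\<close> the same value is a multiple of
  \<open>\<phi> (monom 1 n * p)\<close>.\<close>

lemma ortho_next_nonzero:
  assumes "ortho n m p" and "coeff p (n + m) = 1" and "\<And>i. i > n + m \<Longrightarrow> coeff p i = 0"
  shows "\<phi> (monom 1 n * p) \<noteq> 0"
proof -
  have "0 < Suc n + m" by simp
  then obtain A B where AB: "\<And>i. i \<ge> Suc n \<Longrightarrow> coeff A i = 0" "\<And>i. i \<ge> m \<Longrightarrow> coeff B i = 0"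
    "\<And>p. (\<And>i. i \<ge> Suc n + m \<Longrightarrow> coeff p i = 0) \<Longrightarrow> form A B p = coeff p (Suc n + m - 1)"
    by (rule typeIE) blast
  have "form A B p = 1" using AB(3)[of p] assms(2,3) by simp
  then show ?thesis using form_ortho_Suc[OF assms(1) AB(1,2)] by auto
qed

lemma ortho_diff_smult:
  assumes "ortho n m p" and "ortho n m q"
  shows "ortho n m (p - smult r q)"
proof -
  have "p - smult r q = p + smult (- r) q" by simp
  then show ?thesis using assms
    by (simp only: ortho_def distrib_left mult_smult_right \<phi>_add \<phi>_smult \<psi>_add \<psi>_smult) simp
qed

lemma projection_Suc:
  assumes IH: "\<And>P. \<exists>R. (\<forall>i\<ge>n + m. coeff R i = 0) \<and> ortho n m (P - R)"
  shows "\<exists>R. (\<forall>i\<ge>Suc n + m. coeff R i = 0) \<and> ortho (Suc n) m (P - R)"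
proof -
  obtain S where S: "\<forall>i\<ge>n + m. coeff S i = 0" "ortho n m (monom 1 (n + m) - S)"
    using IH by blast
  obtain R where R: "\<forall>i\<ge>n + m. coeff R i = 0" "ortho n m (P - R)"
    using IH by blast
  define L where "L = monom 1 (n + m) - S"
  have L: "coeff L (n + m) = 1" "\<And>i. i > n + m \<Longrightarrow> coeff L i = 0"
    using S(1) by (auto simp: L_def)
  define h where "h = \<phi> (monom 1 n * L)"
  have h: "h \<noteq> 0"
    unfolding h_def using ortho_next_nonzero[OF _ L] S(2) by (simp add: L_def)
  \<comment> \<open>\<open>r\<close> is the multiple of the monic type II polynomial
    \<open>L\<close> that cancels the one remaining condition; subtracting it keeps the conditions
    for \<open>(n, m)\<close>.\<close>
  define r where "r = \<phi> (monom 1 n * (P - R)) / h"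
  have "ortho n m (P - R - smult r L)"
    using ortho_diff_smult R(2) S(2) by (simp add: L_def)
  moreover have "\<phi> (monom 1 n * (P - R - smult r L)) = 0"
  proof -
    have "P - R - smult r L = (P - R) + smult (- r) L" by simp
    then have "\<phi> (monom 1 n * (P - R - smult r L)) = \<phi> (monom 1 n * (P - R)) - r * h"
      by (simp only: distrib_left mult_smult_right \<phi>_add \<phi>_smult h_def)
    then show ?thesis using h by (simp add: r_def)
  qed
  ultimately have "ortho (Suc n) m (P - (R + smult r L))"
    by (auto simp: ortho_def less_Suc_eq diff_diff_add)
  moreover have "\<forall>i\<ge>Suc n + m. coeff (R + smult r L) i = 0"
    using R(1) L(2) by auto
  ultimately show ?thesis by blast
qed

text \<open>The form vanishes on the monic type II polynomial for \<open>(n, m)\<close>, but there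
  it equals \<open>coeff A n\<close> times a number that is nonzero by
  \<open>ortho_next_nonzero\<close>.\<close>

lemma typeI_unique_Suc:
  assumes "\<exists>R. (\<forall>i\<ge>n + m. coeff R i = 0) \<and> ortho n m (monom 1 (n + m) - R)"
    and "\<And>i. i \<ge> Suc n \<Longrightarrow> coeff A i = 0" and "\<And>i. i \<ge> m \<Longrightarrow> coeff B i = 0"
    and "\<And>j. j < Suc n + m \<Longrightarrow> form A B (monom 1 j) = 0"
  shows "coeff A n = 0"
proof -
  obtain S where S: "\<forall>i\<ge>n + m. coeff S i = 0" "ortho n m (monom 1 (n + m) - S)"
    using assms(1) by blast
  define L where "L = monom 1 (n + m) - S"
  have L: "coeff L (n + m) = 1" "\<And>i. i > n + m \<Longrightarrow> coeff L i = 0"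
    using S(1) by (auto simp: L_def)
  have o: "ortho n m L" using S(2) by (simp add: L_def)
  have "form A B L = 0"
    using form_eq_sum[of "Suc n + m" L A B] L(2) assms(4) by simp
  then show ?thesis
    using form_ortho_Suc[OF o assms(2,3)] ortho_next_nonzero[OF o L] by simp
qed

text \<open>Lets every argument that raises the first index serve for the second one too.\<close>

lemma swap: "normal_pair \<psi> \<phi>"
proof
  fix n m :: nat
  assume "0 < n + m"
  with typeI_ex[of m n]
  show "\<exists>A B. (\<forall>i\<ge>n. coeff A i = 0) \<and> (\<forall>i\<ge>m. coeff B i = 0) \<and>
      (\<forall>j. Suc j \<le> n + m \<longrightarrow>
        \<psi> (monom 1 j * A) + \<phi> (monom 1 j * B) = (if Suc j = n + m then 1 else 0))"
    by (simp only: add.commute) blast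
qed (auto simp: \<phi>_add \<phi>_smult \<psi>_add \<psi>_smult)

interpretation swap: normal_pair \<psi> \<phi>
  by (rule swap)

lemma swap_ortho: "swap.ortho m n p \<longleftrightarrow> ortho n m p"
  by (auto simp: swap.ortho_def ortho_def)

lemma swap_form: "swap.form B A p = form A B p"
  by (simp add: swap.form_def form_def)

text \<open>Modulo the orthogonality conditions, every polynomial reduces to degree below
  \<open>n + m\<close>. The induction raises the first index while it is positive, and otherwise the
  second through \<open>swap\<close>.\<close>

lemma projection: "\<exists>R. (\<forall>i\<ge>n + m. coeff R i = 0) \<and> ortho n m (P - R)"
proof (induction "n + m" arbitrary: n m P)
  case 0
  then show ?case by (intro exI[of _ 0]) (auto simp: ortho_def)
next
  case (Suc k)
  show ?case
  proof (cases n)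
    case (Suc n')
    then show ?thesis using projection_Suc[of n' m P] Suc.hyps by simp
  next
    case 0
    then obtain m' where m: "m = Suc m'" using Suc.hyps by (cases m) auto
    then show ?thesis
      using swap.projection_Suc[of m' n P] Suc.hyps(1)[of n m'] Suc.hyps(2)
      by (simp add: swap_ortho add.commute)
  qed
qed

text \<open>The polynomial is \<open>monom 1 (n + m)\<close> minus its reduction by
  \<open>projection\<close>.\<close>

lemma typeII_ex:
  obtains L where "degree L = n + m" "lead_coeff L = 1" "ortho n m L"
proof -
  obtain S where S: "\<forall>i\<ge>n + m. coeff S i = 0" "ortho n m (monom 1 (n + m) - S)"
    using projection by blast
  define L where "L = monom 1 (n + m) - S"
  have "coeff L (n + m) = 1" "\<forall>i>n + m. coeff L i = 0"
    using S(1) by (auto simp: L_def)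
  then have "degree L = n + m"
    by (intro antisym degree_le le_degree) auto
  with S \<open>coeff L (n + m) = 1\<close> show thesis
    by (intro that[of L]) (simp_all add: L_def)
qed

lemma ortho_eq_0:
  assumes "ortho n m p" and "\<And>i. i \<ge> n + m \<Longrightarrow> coeff p i = 0"
  shows "p = 0"
proof (rule ccontr)
  assume "p \<noteq> 0"
  then have d: "degree p < n + m"
    using assms(2) by (metis leading_coeff_0_iff not_le)
  \<comment> \<open>A smaller multi-index of total \<open>degree p + 1\<close>: its type I form
    extracts the leading coefficient of \<open>p\<close>, yet it involves only conditions that
    \<open>p\<close> satisfies.\<close>
  define n' m' where "n' = min n (Suc (degree p))" and "m' = Suc (degree p) - n'"
  have nm: "n' \<le> n" "m' \<le> m" "n' + m' = Suc (degree p)"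
    using d by (auto simp: n'_def m'_def)
  obtain A B where AB: "\<And>i. i \<ge> n' \<Longrightarrow> coeff A i = 0" "\<And>i. i \<ge> m' \<Longrightarrow> coeff B i = 0"
    "\<And>p. (\<And>i. i \<ge> n' + m' \<Longrightarrow> coeff p i = 0) \<Longrightarrow> form A B p = coeff p (n' + m' - 1)"
    using nm(3) by (elim typeIE[of n' m', rotated]) auto
  have "form A B p = lead_coeff p"
    using AB(3)[of p] nm(3) by (auto simp: coeff_eq_0)
  moreover have "form A B p = 0"
    using form_ortho[OF assms(1), of A B] AB(1,2) nm by auto
  ultimately show False using \<open>p \<noteq> 0\<close> by simp
qed

text \<open>Uniqueness of type I: the top coefficients are shown to vanish one at a time, first
  those of \<open>A\<close>, then those of \<open>B\<close>.\<close>

lemma form_eq_0_imp: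
  assumes "\<And>i. i \<ge> n \<Longrightarrow> coeff A i = 0" and "\<And>i. i \<ge> m \<Longrightarrow> coeff B i = 0"
    and "\<And>j. j < n + m \<Longrightarrow> form A B (monom 1 j) = 0"
  shows "A = 0 \<and> B = 0"
  using assms
proof (induction "n + m" arbitrary: n m)
  case 0
  then show ?case by (auto intro: poly_eqI)
next
  case (Suc k)
  show ?case
  proof (cases n)
    case n: (Suc n')
    have "coeff A n' = 0"
      using typeI_unique_Suc[of n' m A B] projection[of n' m] Suc.prems n by simp
    then have "coeff A i = 0" if "i \<ge> n'" for i
      using Suc.prems(1)[of i] that n by (cases "i = n'") auto
    then show ?thesis
      using Suc.hyps(1)[of n' m] Suc.hyps(2) Suc.prems(2,3) n by simp
  next
    case 0
    then obtain m' where m: "m = Suc m'" using Suc.hyps by (cases m) auto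
    have "coeff B m' = 0"
      using swap.typeI_unique_Suc[of m' n B A] projection[of n m'] Suc.prems m
      by (simp add: swap_ortho swap_form add.commute)
    then have "coeff B i = 0" if "i \<ge> m'" for i
      using Suc.prems(2)[of i] that m by (cases "i = m'") auto
    then show ?thesis
      using Suc.hyps(1)[of n m'] Suc.hyps(2) Suc.prems(1,3) m by simp
  qed
qed

end

section \<open>Residues as power series coefficients\<close>

text \<open>The expansion of \<open>(d + X) ^ (- m)\<close>; for \<open>m = 0\<close> the truncated \<open>m + i - 1\<close> gives \<open>1\<close>.\<close>

definition inv_lin_pow :: "real \<Rightarrow> nat \<Rightarrow> real fps" where
  "inv_lin_pow d m = Abs_fps (\<lambda>i. (- 1) ^ i * real ((m + i - 1) choose i) / d ^ (m + i))"

lemma inv_lin_pow_0 [simp]: "inv_lin_pow d 0 = 1"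
  by (rule fps_ext) (simp add: inv_lin_pow_def fps_one_nth)

text \<open>Pascal's rule, coefficient by coefficient.\<close>

lemma inv_lin_pow_Suc:
  assumes "d \<noteq> 0"
  shows "(fps_const d + fps_X) * inv_lin_pow d (Suc m) = inv_lin_pow d m"
proof (rule fps_ext)
  fix i
  show "fps_nth ((fps_const d + fps_X) * inv_lin_pow d (Suc m)) i = fps_nth (inv_lin_pow d m) i"
  proof (cases i)
    case 0
    then show ?thesis using assms by (simp add: inv_lin_pow_def distrib_right)
  next
    case (Suc k)
    then show ?thesis using assms
      by (simp add: inv_lin_pow_def distrib_right field_simps)
  qed
qed

lemma fps_nth_lin_pow:
  "fps_nth ((fps_const s + fps_X) ^ j) i = real (j choose i) * (s::real) ^ (j - i)"
proof (induction j arbitrary: i)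
  case 0
  then show ?case by (simp add: fps_one_nth)
next
  case (Suc j)
  show ?case
  proof (cases i)
    case 0
    then show ?thesis using Suc by (simp add: distrib_right)
  next
    case (Suc k)
    \<comment> \<open>For \<open>k \<ge> j\<close> the truncated exponents do not match, but then
      the binomial coefficient is 0.\<close>
    have "real (j choose Suc k) * (s * s ^ (j - Suc k)) = real (j choose Suc k) * s ^ (j - k)"
      by (cases "k < j") (auto simp flip: power_Suc simp: Suc_diff_Suc)
    then show ?thesis using Suc Suc.IH
      by (simp add: distrib_right algebra_simps)
  qed
qed

text \<open>The residue of \<open>z ^ j / ((z - s) ^ n * (z - t) ^ m)\<close> at \<open>z = s\<close>.\<close>

definition res_pow :: "real \<Rightarrow> real \<Rightarrow> nat \<Rightarrow> nat \<Rightarrow> nat \<Rightarrow> real" where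
  "res_pow s t n m j = fps_nth (fps_X * (fps_const s + fps_X) ^ j * inv_lin_pow (s - t) m) n"

text \<open>A Cauchy product. The factor \<open>fps_X\<close> in \<open>res_pow\<close> shifts the
  index from \<open>n - 1\<close> to \<open>n\<close>, so that \<open>n = 0\<close>, where there is
  no pole at \<open>s\<close>, gives the empty sum.\<close>

lemma res_pow_eq_sum:
  "res_pow s t n m j =
     (\<Sum>i<n. real (j choose i) * s ^ (j - i) * fps_nth (inv_lin_pow (s - t) m) (n - 1 - i))"
proof (cases n)
  case 0
  then show ?thesis by (simp add: res_pow_def)
next
  case (Suc k)
  have "res_pow s t n m j = fps_nth ((fps_const s + fps_X) ^ j * inv_lin_pow (s - t) m) k"
    by (simp add: res_pow_def Suc mult.assoc)
  then show ?thesis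
    by (simp add: Suc fps_mult_nth fps_nth_lin_pow atLeast0AtMost lessThan_Suc_atMost
        del: sum.lessThan_Suc)
qed

lemma res_pow_0 [simp]: "res_pow s t 0 m j = 0"
  by (simp add: res_pow_eq_sum)

text \<open>This is \<open>s - t = (z - t) - (z - s)\<close>, each difference cancelling one factor
  of the denominator; in the local variable, \<open>z - t\<close> is
  \<open>s - t + X\<close>.\<close>

lemma res_pow_diff:
  assumes "s \<noteq> t"
  shows "(s - t) * res_pow s t (Suc n) (Suc m) j = res_pow s t (Suc n) m j - res_pow s t n (Suc m) j"
proof -
  define Y where "Y = fps_X * (fps_const s + fps_X) ^ j"
  define G where "G = inv_lin_pow (s - t) (Suc m)"
  have "inv_lin_pow (s - t) m = (fps_const (s - t) + fps_X) * G"
    using inv_lin_pow_Suc[of "s - t" m] assms by (simp add: G_def)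
  then have "Y * inv_lin_pow (s - t) m = fps_const (s - t) * (Y * G) + fps_X * (Y * G)"
    by (simp add: algebra_simps del: fps_const_sub)
  then have "fps_nth (Y * inv_lin_pow (s - t) m) (Suc n) =
               (s - t) * fps_nth (Y * G) (Suc n) + fps_nth (Y * G) n"
    by simp
  then show ?thesis by (simp add: res_pow_def Y_def G_def)
qed

text \<open>From \<open>z = s + (z - s)\<close>, where \<open>z - s\<close> lowers the order of the
  pole at \<open>s\<close>.\<close>

lemma res_pow_Suc:
  "res_pow s t (Suc n) m (Suc j) = s * res_pow s t (Suc n) m j + res_pow s t n m j"
proof -
  define Y where "Y = fps_X * (fps_const s + fps_X) ^ j * inv_lin_pow (s - t) m"
  have "fps_X * (fps_const s + fps_X) ^ Suc j * inv_lin_pow (s - t) m = fps_const s * Y + fps_X * Y"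
    by (simp add: Y_def algebra_simps)
  then show ?thesis by (simp add: res_pow_def Y_def)
qed

text \<open>The same splitting \<open>z = s + (z - s)\<close>, now for the residue at
  \<open>t\<close>, where \<open>z - s\<close> is the series \<open>t - s + X\<close>.\<close>

lemma res_pow_Suc':
  assumes "s \<noteq> t"
  shows "res_pow t s m (Suc n) (Suc j) = s * res_pow t s m (Suc n) j + res_pow t s m n j"
proof -
  define Y where "Y = fps_X * (fps_const t + fps_X) ^ j"
  define G where "G = inv_lin_pow (t - s) (Suc n)"
  have G: "inv_lin_pow (t - s) n = (fps_const (t - s) + fps_X) * G"
    using inv_lin_pow_Suc[of "t - s" n] assms by (simp add: G_def)
  have "fps_X * (fps_const t + fps_X) ^ Suc j * G = (fps_const t + fps_X) * (Y * G)"
    by (simp add: Y_def mult_ac)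
  also have "\<dots> = (fps_const s + (fps_const (t - s) + fps_X)) * (Y * G)"
    by (simp flip: add.assoc)
  also have "\<dots> = fps_const s * (Y * G) + Y * ((fps_const (t - s) + fps_X) * G)"
    by (simp only: distrib_right distrib_left mult_ac)
  finally have "fps_X * (fps_const t + fps_X) ^ Suc j * G =
          fps_const s * (Y * G) + Y * inv_lin_pow (t - s) n"
    by (simp only: G)
  then show ?thesis by (simp add: res_pow_def Y_def G_def)
qed

text \<open>The two residues add up to minus the residue at infinity.\<close>

lemma res_pow_sum:
  assumes "s \<noteq> t" and "Suc j \<le> n + m"
  shows "res_pow s t n m j + res_pow t s m n j = (if Suc j = n + m then 1 else 0)"
  using assms
proof (induction "n + m" arbitrary: n m j s t)
  case 0
  then show ?case by simp
next
  case (Suc k)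
  have step: "res_pow s t n m j + res_pow t s m n j = (if Suc j = n + m then 1 else 0)"
    if st: "s \<noteq> t" and nm: "n + m = Suc k" "Suc j \<le> n + m" and n: "n = Suc n'"
    for s t n m j n'
    using nm(2)
  proof (induction j)
    case 0
    show ?case
    proof (cases m)
      case 0
      then show ?thesis using n by (simp add: res_pow_def)
    next
      case (Suc m')
      \<comment> \<open>Both brackets have total index \<open>n + m - 1\<close>, so by induction
        they have the same value and cancel.\<close>
      have "(s - t) * (res_pow s t n m 0 + res_pow t s m n 0) =
          (res_pow s t n m' 0 + res_pow t s m' n 0) - (res_pow s t n' m 0 + res_pow t s m n' 0)"
        using res_pow_diff[of s t n' m' 0] res_pow_diff[of t s m' n' 0] st
        by (simp add: n Suc algebra_simps)
      also have "\<dots> = 0"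
        using Suc.hyps(1)[of n m' s t 0] Suc.hyps(1)[of n' m s t 0] st nm n Suc by simp
      finally show ?thesis using st n Suc by simp
    qed
  next
    case (Suc j)
    then have "n' + m = k" "Suc j \<le> n' + m" using nm n by auto
    then have "res_pow s t n' m j + res_pow t s m n' j = (if Suc j = n' + m then 1 else 0)"
      using Suc.hyps(1)[of n' m s t j] st by simp
    moreover have "res_pow s t n m j + res_pow t s m n j = 0"
      using Suc by simp
    moreover have "res_pow s t n m (Suc j) + res_pow t s m n (Suc j) =
        s * (res_pow s t n m j + res_pow t s m n j) + (res_pow s t n' m j + res_pow t s m n' j)"
      using res_pow_Suc[of s t n' m j] res_pow_Suc'[OF st, of m n' j]
      by (simp add: n algebra_simps)
    ultimately show ?case using n by simp
  qed
  show ?case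
  proof (cases n)
    case (Suc n')
    then show ?thesis using step[of s t n m j n'] Suc.prems Suc.hyps(2) by simp
  next
    case 0
    then obtain m' where "m = Suc m'" using Suc.hyps by (cases m) auto
    then show ?thesis using step[of t s m n j m'] Suc.prems Suc.hyps(2) by (simp add: add.commute)
  qed
qed

section \<open>Binomial coefficients as moments, by Chu-Vandermonde\<close>

lemma pochhammer_ne_0_if_pos: "(x::real) > 0 \<Longrightarrow> pochhammer x n \<noteq> 0"
  using pochhammer_pos[of x n] by simp

text \<open>Chu-Vandermonde for the negated upper argument, split into
  \<open>- (\<alpha> + 1 + real j)\<close> and \<open>\<alpha> + real i\<close>. The factors
  \<open>pochhammer (\<alpha> + 1 + real j) l\<close> are those that multiplication by
  \<open>x ^ l\<close> produces in the moments.\<close>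

lemma binomial_eq_pochhammer_sum:
  assumes "\<alpha> > (-1 :: real)"
  shows "real (j choose i) = (\<Sum>l\<le>i. (- 1) ^ (i + l) * pochhammer (\<alpha> + 1) i /
           (fact l * fact (i - l) * pochhammer (\<alpha> + 1) l) * pochhammer (\<alpha> + 1 + real j) l)"
proof -
  have "(- 1) ^ i * real (j choose i) = (- (real j - real i + 1)) gchoose i"
    unfolding gbinomial_minus by (simp add: binomial_gbinomial)
  also have "- (real j - real i + 1) = - (\<alpha> + 1 + real j) + (\<alpha> + real i)" by simp
  also have "\<dots> gchoose i =
      (\<Sum>l\<le>i. (- (\<alpha> + 1 + real j) gchoose l) * ((\<alpha> + real i) gchoose (i - l)))"
    by (simp only: gbinomial_Vandermonde[symmetric] atLeast0AtMost)
  also have "\<dots> = (\<Sum>l\<le>i. (- 1) ^ l * pochhammer (\<alpha> + 1) i /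
           (fact l * fact (i - l) * pochhammer (\<alpha> + 1) l) * pochhammer (\<alpha> + 1 + real j) l)"
  proof (rule sum.cong)
    fix l assume "l \<in> {..i}"
    then have l: "l \<le> i" by simp
    have "pochhammer (\<alpha> + 1) i = pochhammer (\<alpha> + 1) l * pochhammer (\<alpha> + 1 + real l) (i - l)"
      by (rule pochhammer_product[OF l])
    moreover have "(\<alpha> + real i) gchoose (i - l) = pochhammer (\<alpha> + 1 + real l) (i - l) / fact (i - l)"
      unfolding gbinomial_pochhammer' using l by (simp add: of_nat_diff algebra_simps)
    moreover have "pochhammer (\<alpha> + 1) l \<noteq> 0" using assms by (simp add: pochhammer_ne_0_if_pos)
    ultimately show "(- (\<alpha> + 1 + real j) gchoose l) * ((\<alpha> + real i) gchoose (i - l)) =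
        (- 1) ^ l * pochhammer (\<alpha> + 1) i /
           (fact l * fact (i - l) * pochhammer (\<alpha> + 1) l) * pochhammer (\<alpha> + 1 + real j) l"
      by (simp add: gbinomial_pochhammer[of "- (\<alpha> + 1 + real j)"] del: minus_add_distrib)
  qed simp
  finally have "(- 1) ^ i * ((- 1) ^ i * real (j choose i)) =
     (- 1) ^ i * (\<Sum>l\<le>i. (- 1) ^ l * pochhammer (\<alpha> + 1) i /
           (fact l * fact (i - l) * pochhammer (\<alpha> + 1) l) * pochhammer (\<alpha> + 1 + real j) l)"
    by simp
  then show ?thesis
    by (simp add: sum_distrib_left power_add mult.assoc flip: power_mult_distrib)
qed

text \<open>
  The polynomial whose \<open>j\<close>-th moment is \<open>\<Gamma>(\<alpha> + 1 + j)\<close> times the coefficient of \<open>X ^ i\<close> in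
  \<open>(1 / c + X) ^ j\<close>.
\<close>

definition binomial_poly :: "real \<Rightarrow> real \<Rightarrow> nat \<Rightarrow> real poly" where
  "binomial_poly \<alpha> c i = (\<Sum>l\<le>i. monom ((- 1) ^ (i + l) * pochhammer (\<alpha> + 1) i /
     (fact l * fact (i - l) * pochhammer (\<alpha> + 1) l) * c ^ (l + i) * c powr (\<alpha> + 1)) l)"

lemma moment_add:
  assumes "\<alpha> > -1" and "c > 0"
  shows "moment \<alpha> c (j + l) =
           Gamma (\<alpha> + 1 + real j) * pochhammer (\<alpha> + 1 + real j) l / (c powr (\<alpha> + 1) * c ^ (j + l))"
proof -
  have "\<alpha> + 1 + real j \<notin> \<int>\<^sub>\<le>\<^sub>0"
    using assms by (auto dest: nonpos_Ints_nonpos)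
  then have "Gamma (\<alpha> + 1 + real j) \<noteq> 0" by (simp add: Gamma_eq_zero_iff)
  then have "Gamma (\<alpha> + 1 + real (j + l)) =
      Gamma (\<alpha> + 1 + real j) * pochhammer (\<alpha> + 1 + real j) l"
    using pochhammer_Gamma[of "\<alpha> + 1 + real j" l] \<open>\<alpha> + 1 + real j \<notin> \<int>\<^sub>\<le>\<^sub>0\<close>
    by (simp add: add.assoc)
  then show ?thesis
    using assms by (simp add: moment_def powr_add flip: powr_realpow)
qed

lemma wint_sum:
  assumes "\<alpha> > -1" and "c k > 0"
  shows "wint \<alpha> c k (\<Sum>i\<in>I. f i) = (\<Sum>i\<in>I. wint \<alpha> c k (f i))"
  using wint_smult[of \<alpha> c k 0 0]
  by (induction I rule: infinite_finite_induct) (auto simp: wint_add[where c = c and k = k, OF assms])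

lemma wint_binomial_poly:
  assumes "\<alpha> > -1" and "c k > 0"
  shows "wint \<alpha> c k (monom 1 j * binomial_poly \<alpha> (c k) i) =
           Gamma (\<alpha> + 1 + real j) * real (j choose i) * (1 / c k) ^ (j - i)"
proof -
  let ?a = "\<lambda>l. (- 1) ^ (i + l) * pochhammer (\<alpha> + 1) i / (fact l * fact (i - l) * pochhammer (\<alpha> + 1) l)"
  have "wint \<alpha> c k (monom 1 j * binomial_poly \<alpha> (c k) i) =
     (\<Sum>l\<le>i. ?a l * c k ^ (l + i) * c k powr (\<alpha> + 1) * moment \<alpha> (c k) (j + l))"
    by (simp add: binomial_poly_def sum_distrib_left mult_monom wint_sum[where c = c and k = k, OF assms]
        wint_monom[where c = c and k = k, OF assms])
  also have "\<dots> = (\<Sum>l\<le>i. ?a l * (Gamma (\<alpha> + 1 + real j) * (c k ^ i / c k ^ j) *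
      pochhammer (\<alpha> + 1 + real j) l))"
  proof (rule sum.cong)
    fix l
    \<comment> \<open>The power \<open>c k ^ l\<close> and the factor
      \<open>c k powr (\<alpha> + 1)\<close> cancel against the moment, so the remaining power of
      \<open>c k\<close> does not depend on \<open>l\<close>.\<close>
    have "c k ^ (l + i) * c k powr (\<alpha> + 1) * moment \<alpha> (c k) (j + l) =
        Gamma (\<alpha> + 1 + real j) * (c k ^ i / c k ^ j) * pochhammer (\<alpha> + 1 + real j) l"
      using assms by (simp add: moment_add power_add)
    then show "?a l * c k ^ (l + i) * c k powr (\<alpha> + 1) * moment \<alpha> (c k) (j + l) =
        ?a l * (Gamma (\<alpha> + 1 + real j) * (c k ^ i / c k ^ j) * pochhammer (\<alpha> + 1 + real j) l)"
      by (simp only: mult.assoc)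
  qed simp
  also have "\<dots> = Gamma (\<alpha> + 1 + real j) * (c k ^ i / c k ^ j) * real (j choose i)"
    unfolding binomial_eq_pochhammer_sum[OF assms(1), of j i]
    by (simp only: sum_distrib_left mult.left_commute)
  also have "\<dots> = Gamma (\<alpha> + 1 + real j) * real (j choose i) * (1 / c k) ^ (j - i)"
    using assms by (cases "i \<le> j") (simp_all add: power_diff power_one_over binomial_eq_0)
  finally show ?thesis .
qed

text \<open>The sum of \<open>res_pow_eq_sum\<close> for poles \<open>1 / c\<close> and
  \<open>1 / d\<close>, with each binomial term replaced by the polynomial that has it as moment. Up
  to a Gamma factor this is the type I polynomial.\<close>

definition typeI_poly :: "real \<Rightarrow> real \<Rightarrow> real \<Rightarrow> nat \<Rightarrow> nat \<Rightarrow> real poly" where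
  "typeI_poly \<alpha> c d n m =
     (\<Sum>i<n. smult (fps_nth (inv_lin_pow (1 / c - 1 / d) m) (n - 1 - i)) (binomial_poly \<alpha> c i))"

lemma wint_typeI_poly:
  assumes "\<alpha> > -1" and "c k > 0"
  shows "wint \<alpha> c k (monom 1 j * typeI_poly \<alpha> (c k) d n m) =
           Gamma (\<alpha> + 1 + real j) * res_pow (1 / c k) (1 / d) n m j"
  by (simp add: typeI_poly_def sum_distrib_left wint_sum[where c = c and k = k, OF assms] wint_smult
      wint_binomial_poly[where c = c and k = k, OF assms] res_pow_eq_sum mult_ac)

lemma coeff_typeI_poly:
  assumes "i \<ge> n"
  shows "coeff (typeI_poly \<alpha> c d n m) i = 0"
  using assms by (auto simp: typeI_poly_def binomial_poly_def coeff_sum intro!: sum.neutral)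

section \<open>The explicit polynomials as Kampe de Feriet series\<close>

lemma pochhammer_minus_nat:
  assumes "i \<le> N"
  shows "pochhammer (- real N) i = (- 1) ^ i * fact N / fact (N - i)"
proof -
  have "real N gchoose i = fact N / (fact i * fact (N - i))"
    using assms by (simp add: binomial_gbinomial[symmetric] binomial_fact)
  then have "(- 1) ^ i * pochhammer (- real N) i = fact N / fact (N - i)"
    by (simp add: gbinomial_pochhammer field_simps)
  moreover have "pochhammer (- real N) i = (- 1) ^ i * ((- 1) ^ i * pochhammer (- real N) i)"
    by (simp flip: mult.assoc power_mult_distrib)
  ultimately show ?thesis by simp
qed

text \<open>Isolates the dependence on \<open>i\<close>: the binomial coefficient becomes a ratio of
  Pochhammer symbols, and what is free of \<open>i\<close> goes into the constant of the final
  formula.\<close>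

lemma fps_nth_inv_lin_pow_ratio:
  assumes "c > 0" "d > 0" "c \<noteq> d" "i \<le> N"
  shows "fps_nth (inv_lin_pow (1 / c - 1 / d) (Suc M)) (N - i) * (- 1) ^ i * c ^ i =
     (- 1) ^ N * fact (N + M) / (fact N * fact M) * (c * d / (d - c)) ^ (N + M + 1) *
     (pochhammer (- real N) i / pochhammer (- real (N + M)) i) * ((d - c) / d) ^ i"
proof -
  define e where "e = 1 / c - 1 / d"
  have e: "e \<noteq> 0" "c * d / (d - c) = 1 / e" "(d - c) / d = c * e"
    using assms by (auto simp: e_def field_simps)
  have N: "Suc M + (N - i) - 1 = N + M - i" using assms by simp
  have ch: "real (N + M - i choose (N - i)) = fact (N + M - i) / (fact (N - i) * fact M)"
    using assms by (subst binomial_fact) (auto simp: field_simps)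
  have sgn: "(- 1 :: real) ^ (N - i) * (- 1) ^ i = (- 1) ^ N"
    using assms by (simp flip: power_add)
  have "N + M + 1 = Suc M + (N - i) + i" using assms by simp
  then have pow: "e ^ i / e ^ (N + M + 1) = 1 / e ^ (Suc M + (N - i))"
    using e(1) by (simp only: power_add) simp
  have poch: "pochhammer (- real N) i / pochhammer (- real (N + M)) i =
      fact N * fact (N + M - i) / (fact (N - i) * fact (N + M))"
    using assms by (simp add: pochhammer_minus_nat del: of_nat_add)
  have "fps_nth (inv_lin_pow e (Suc M)) (N - i) * (- 1) ^ i * c ^ i =
      ((- 1) ^ (N - i) * (- 1) ^ i) * (fact (N + M - i) / (fact (N - i) * fact M)) * c ^ i *
      (1 / e ^ (Suc M + (N - i)))"
    unfolding inv_lin_pow_def fps_nth_Abs_fps N ch by simp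
  also have "\<dots> = (- 1) ^ N * fact (N + M) / (fact N * fact M) * (1 / e) ^ (N + M + 1) *
     (fact N * fact (N + M - i) / (fact (N - i) * fact (N + M))) * (c * e) ^ i"
    unfolding sgn pow[symmetric] power_mult_distrib power_one_over by (simp add: mult_ac)
  finally show ?thesis unfolding e_def[symmetric] e(2,3) poch .
qed

text \<open>Common middle term between the Kampe de Feriet series and the double sum;
  \<open>N\<close> and \<open>M\<close> are the two entries of the multi-index, each less 1.\<close>

definition kdf_sum :: "real \<Rightarrow> nat \<Rightarrow> nat \<Rightarrow> real \<Rightarrow> real \<Rightarrow> real \<Rightarrow> real" where
  "kdf_sum \<alpha> N M u v x = (\<Sum>(l, m) | l + m \<le> N.
     pochhammer (- real N) (l + m) * pochhammer (\<alpha> + 1) (l + m) /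
       (fact l * fact m * pochhammer (- real (N + M)) (l + m) * pochhammer (\<alpha> + 1) l) *
       u ^ l * v ^ m * x ^ l)"

lemma poly_typeI_poly:
  assumes "\<alpha> > -1" "c > 0" "d > 0" "c \<noteq> d"
  shows "poly (typeI_poly \<alpha> c d (Suc N) (Suc M)) x =
     (- 1) ^ N * fact (N + M) / (fact N * fact M) * c powr (\<alpha> + 1) * (c * d / (d - c)) ^ (N + M + 1) *
     kdf_sum \<alpha> N M ((c - d) * c / d) ((d - c) / d) x"
proof -
  let ?g = "\<lambda>i. fps_nth (inv_lin_pow (1 / c - 1 / d) (Suc M)) (N - i)"
  let ?b = "\<lambda>i l. (- 1) ^ (i + l) * pochhammer (\<alpha> + 1) i /
     (fact l * fact (i - l) * pochhammer (\<alpha> + 1) l) * c ^ (l + i) * c powr (\<alpha> + 1) * x ^ l"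
  let ?K = "(- 1) ^ N * fact (N + M) / (fact N * fact M) * c powr (\<alpha> + 1) * (c * d / (d - c)) ^ (N + M + 1)"
  let ?t = "\<lambda>l m. pochhammer (- real N) (l + m) * pochhammer (\<alpha> + 1) (l + m) /
       (fact l * fact m * pochhammer (- real (N + M)) (l + m) * pochhammer (\<alpha> + 1) l) *
       ((c - d) * c / d) ^ l * ((d - c) / d) ^ m * x ^ l"
  have "poly (typeI_poly \<alpha> c d (Suc N) (Suc M)) x = (\<Sum>i\<le>N. \<Sum>l\<le>i. ?g i * ?b i l)"
    by (simp add: typeI_poly_def binomial_poly_def poly_sum poly_monom lessThan_Suc_atMost
        sum_distrib_left del: sum.lessThan_Suc)
  also have "\<dots> = (\<Sum>i\<le>N. \<Sum>l\<le>i. ?K * ?t l (i - l))"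
  proof (intro sum.cong refl)
    fix i l assume "i \<in> {..N}" "l \<in> {..i}"
    then have il: "i \<le> N" "l \<le> i" by auto
    define v where "v = (d - c) / d"
    \<comment> \<open>The two arguments of the series differ by the factor \<open>- c\<close>; this
      absorbs the signs and powers of \<open>c\<close> with exponent \<open>l\<close> from
      \<open>binomial_poly\<close>.\<close>
    have "(c - d) * c / d = (- 1) * c * v" using assms by (simp add: v_def field_simps)
    then have u: "((c - d) * c / d) ^ l = (- 1) ^ l * c ^ l * v ^ l"
      by (simp only: power_mult_distrib)
    have v: "v ^ i = v ^ l * v ^ (i - l)" using il by (simp flip: power_add)
    note r = fps_nth_inv_lin_pow_ratio[OF assms(2-4) il(1), of M, folded v_def]
    have "?g i * ?b i l = (?g i * (- 1) ^ i * c ^ i) * ((- 1) ^ l * c ^ l * x ^ l * c powr (\<alpha> + 1) *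
        pochhammer (\<alpha> + 1) i / (fact l * fact (i - l) * pochhammer (\<alpha> + 1) l))"
      by (simp add: power_add)
    also have "\<dots> = ?K * ?t l (i - l)"
      unfolding r u v_def[symmetric] v le_add_diff_inverse[OF il(2)]
      by (simp only: divide_inverse inverse_mult_distrib mult_ac)
    finally show "?g i * ?b i l = ?K * ?t l (i - l)" .
  qed
  also have "\<dots> = (\<Sum>(l, m) | l + m \<le> N. ?K * ?t l m)"
    by (rule sum.triangle_reindex_eq[symmetric])
  also have "\<dots> = ?K * kdf_sum \<alpha> N M ((c - d) * c / d) ((d - c) / d) x"
    by (simp only: kdf_sum_def sum_distrib_left case_prod_unfold)
  finally show ?thesis .
qed

lemma kdf_sum_eq_double_sum:
  "kdf_sum \<alpha> N M u v x = (\<Sum>l = 0..N. \<Sum>m = 0..N - l.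
     pochhammer (- real N) (l + m) * pochhammer (\<alpha> + 1) (l + m) /
       (fact l * fact m * pochhammer (- real (N + M)) (l + m) * pochhammer (\<alpha> + 1) l) *
       u ^ l * v ^ m * x ^ l)"
proof -
  have "{(l, m). l + m \<le> N} = Sigma {0..N} (\<lambda>l. {0..N - l})" by auto
  then show ?thesis by (simp add: kdf_sum_def sum.Sigma)
qed

text \<open>Outside the triangle the numerator \<open>pochhammer (- real N) (l + m)\<close> is 0, so
  the term is 0 even where the denominator vanishes too.\<close>

lemma kampe_de_feriet_eq_kdf_sum:
  "kampe_de_feriet [- real N, \<alpha> + 1] [] [] [- real (N + M)] [\<alpha> + 1] [] (u * x) v = kdf_sum \<alpha> N M u v x"
proof -
  let ?T = "{(l, m). l + m \<le> N}"
  have fin: "finite ?T"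
    by (rule finite_subset[of _ "{..N} \<times> {..N}"]) auto
  have "kampe_de_feriet [- real N, \<alpha> + 1] [] [] [- real (N + M)] [\<alpha> + 1] [] (u * x) v =
      (\<Sum>\<^sub>\<infinity>(l, m)\<in>?T. pochhammer (- real N) (l + m) * pochhammer (\<alpha> + 1) (l + m) /
       (fact l * fact m * pochhammer (- real (N + M)) (l + m) * pochhammer (\<alpha> + 1) l) *
       u ^ l * v ^ m * x ^ l)"
    unfolding kampe_de_feriet_def
  proof (rule infsum_cong_neutral)
    fix z assume "z \<in> UNIV \<inter> ?T"
    show "(case z of (l, m) \<Rightarrow>
        pochs [- real N, \<alpha> + 1] (l + m) / pochs [- real (N + M)] (l + m) *
        (pochs [] l / pochs [\<alpha> + 1] l) * (pochs [] m / pochs [] m) *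
        ((u * x) ^ l / fact l) * (v ^ m / fact m)) =
      (case z of (l, m) \<Rightarrow> pochhammer (- real N) (l + m) * pochhammer (\<alpha> + 1) (l + m) /
       (fact l * fact m * pochhammer (- real (N + M)) (l + m) * pochhammer (\<alpha> + 1) l) *
       u ^ l * v ^ m * x ^ l)"
      by (simp add: pochs_def power_mult_distrib split: prod.split)
         (simp only: divide_inverse inverse_mult_distrib mult_ac simp_thms)
  qed (auto simp: pochs_def pochhammer_of_nat_eq_0_lemma)
  then show ?thesis using fin by (simp add: kdf_sum_def)
qed

section \<open>Biorthogonality and identification of the type I polynomials\<close>

lemma typeI_poly_biorthogonal:
  assumes "\<alpha> > -1" and "c 1 > 0" and "c 2 > 0" and "c 1 \<noteq> c 2" and "Suc j \<le> n + m"
  defines "r \<equiv> 1 / Gamma (\<alpha> + real n + real m)"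
  shows "wint \<alpha> c 1 (monom 1 j * smult r (typeI_poly \<alpha> (c 1) (c 2) n m)) +
         wint \<alpha> c 2 (monom 1 j * smult r (typeI_poly \<alpha> (c 2) (c 1) m n)) =
         (if Suc j = n + m then 1 else 0)"
proof -
  have "wint \<alpha> c 1 (monom 1 j * smult r (typeI_poly \<alpha> (c 1) (c 2) n m)) +
         wint \<alpha> c 2 (monom 1 j * smult r (typeI_poly \<alpha> (c 2) (c 1) m n)) =
        r * Gamma (\<alpha> + 1 + real j) *
        (res_pow (1 / c 1) (1 / c 2) n m j + res_pow (1 / c 2) (1 / c 1) m n j)"
    using assms by (simp add: wint_smult wint_typeI_poly algebra_simps del: One_nat_def)
  also have "\<dots> = r * Gamma (\<alpha> + 1 + real j) * (if Suc j = n + m then 1 else 0)"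
    using assms by (subst res_pow_sum) auto
  also have "\<dots> = (if Suc j = n + m then 1 else 0)"
  proof (cases "Suc j = n + m")
    \<comment> \<open>At the only index with a nonzero value, the Gamma factor of the moment is the
      reciprocal of \<open>r\<close>.\<close>
    case True
    then have eq: "\<alpha> + real n + real m = \<alpha> + 1 + real j"
      by (simp flip: of_nat_add of_nat_Suc add: add.assoc)
    have "Gamma (\<alpha> + 1 + real j) > 0"
      using assms(1) by (intro Gamma_real_pos) simp
    then show ?thesis using True unfolding r_def eq by simp
  qed simp
  finally show ?thesis .
qed

text \<open>The explicit forms exist for all \<open>n\<close> and \<open>m\<close>, also when one of
  them is 0, as the abstract part requires.\<close>

lemma normal_pair_wint:
  assumes "\<alpha> > -1" and "c 1 > 0" and "c 2 > 0" and "c 1 \<noteq> c 2"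
  shows "normal_pair (wint \<alpha> c 1) (wint \<alpha> c 2)"
proof
  fix n m :: nat
  define r where "r = 1 / Gamma (\<alpha> + real n + real m)"
  show "\<exists>A B. (\<forall>i\<ge>n. coeff A i = 0) \<and> (\<forall>i\<ge>m. coeff B i = 0) \<and>
      (\<forall>j. Suc j \<le> n + m \<longrightarrow> wint \<alpha> c 1 (monom 1 j * A) + wint \<alpha> c 2 (monom 1 j * B) =
        (if Suc j = n + m then 1 else 0))"
    using typeI_poly_biorthogonal[OF assms, of _ n m]
    by (intro exI[of _ "smult r (typeI_poly \<alpha> (c 1) (c 2) n m)"]
        exI[of _ "smult r (typeI_poly \<alpha> (c 2) (c 1) m n)"])
       (auto simp: coeff_typeI_poly r_def simp del: One_nat_def)
qed (use assms in \<open>auto simp: wint_add wint_smult simp del: One_nat_def\<close>)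

lemma degree_less_iff_coeff:
  fixes p :: "'a::zero poly"
  shows "p = 0 \<or> degree p < n \<longleftrightarrow> (\<forall>i\<ge>n. coeff p i = 0)"
  by (metis coeff_0 coeff_eq_0 leading_coeff_0_iff not_le order_less_le_trans)

context
  fixes \<alpha> :: real and c :: "nat \<Rightarrow> real"
  assumes \<alpha>: "\<alpha> > -1" and c1: "c 1 > 0" and c2: "c 2 > 0" and c12: "c 1 \<noteq> c 2"
begin

interpretation normal_pair "wint \<alpha> c 1" "wint \<alpha> c 2"
  by (rule normal_pair_wint[OF \<alpha> c1 c2 c12])

lemma is_laguerre2_typeII_iff:
  "is_laguerre2_typeII \<alpha> c m L \<longleftrightarrow>
     lead_coeff L = 1 \<and> degree L = m 1 + m 2 \<and> ortho (m 1) (m 2) L"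
  by (simp add: is_laguerre2_typeII_def ortho_def wint_def poly_monom
      del: One_nat_def)

text \<open>Two monic candidates differ by an orthogonal polynomial of lower degree, which
  \<open>ortho_eq_0\<close> forces to be 0.\<close>

lemma is_laguerre2_typeII_laguerre2_typeII: "is_laguerre2_typeII \<alpha> c m (laguerre2_typeII \<alpha> c m)"
  unfolding laguerre2_typeII_def
proof (rule theI')
  obtain L where L: "degree L = m 1 + m 2" "lead_coeff L = 1" "ortho (m 1) (m 2) L"
    by (rule typeII_ex)
  show "\<exists>!L. is_laguerre2_typeII \<alpha> c m L"
  proof (rule ex1I[of _ L])
    fix L' assume "is_laguerre2_typeII \<alpha> c m L'"
    then have L': "degree L' = m 1 + m 2" "lead_coeff L' = 1" "ortho (m 1) (m 2) L'"
      unfolding is_laguerre2_typeII_iff by blast+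
    have "ortho (m 1) (m 2) (L' - L)"
      using ortho_diff_smult[OF L'(3) L(3), of 1] by simp
    moreover have "coeff (L' - L) i = 0" if "i \<ge> m 1 + m 2" for i
      using L(1,2) L'(1,2) that by (cases "i = m 1 + m 2") (auto simp: coeff_eq_0)
    ultimately have "L' - L = 0" by (rule ortho_eq_0)
    then show "L' = L" by simp
  qed (use L in \<open>simp add: is_laguerre2_typeII_iff del: One_nat_def\<close>)
qed

text \<open>A form that kills all powers below \<open>N\<close> takes the same value on every monic
  polynomial of degree \<open>N\<close>, so normalization against the type II polynomials is one
  condition on \<open>monom 1 N\<close>.\<close>

lemma is_laguerre2_typeI_iff:
  assumes "n 1 + n 2 = Suc N"
  shows "is_laguerre2_typeI \<alpha> c n A B \<longleftrightarrow>
     (\<forall>i\<ge>n 1. coeff A i = 0) \<and> (\<forall>i\<ge>n 2. coeff B i = 0) \<and>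
     (\<forall>j\<le>N. form A B (monom 1 j) = (if j = N then 1 else 0))"
proof -
  have form: "(LBINT x:{0..}. poly p x * (poly A x * weight \<alpha> c 1 x + poly B x * weight \<alpha> c 2 x)) =
      form A B p" for p
    using LBINT_typeI[OF \<alpha> c1 c2] by (simp add: form_def del: One_nat_def)
  have monic: "form A B L = form A B (monom 1 N)"
    if "\<forall>j<N. form A B (monom 1 j) = 0" "degree L = N" "lead_coeff L = 1" for L
    using form_eq_sum[of "Suc N" L A B] that by (simp add: coeff_eq_0)
  have II: "degree (laguerre2_typeII \<alpha> c m) = N" "lead_coeff (laguerre2_typeII \<alpha> c m) = 1"
    if "m 1 + m 2 = N" for m
    using is_laguerre2_typeII_laguerre2_typeII[of m, unfolded is_laguerre2_typeII_iff] that by auto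
  have "is_laguerre2_typeI \<alpha> c n A B \<longleftrightarrow>
     (\<forall>i\<ge>n 1. coeff A i = 0) \<and> (\<forall>i\<ge>n 2. coeff B i = 0) \<and>
     (\<forall>j<N. form A B (monom 1 j) = 0) \<and>
     (\<forall>m. m 1 + m 2 = N \<longrightarrow> form A B (laguerre2_typeII \<alpha> c m) = 1)"
    unfolding is_laguerre2_typeI_def degree_less_iff_coeff form form[of "monom 1 _", unfolded poly_monom mult_1_left] assms
    by (simp add: Suc_le_eq)
  also have "\<dots> \<longleftrightarrow> (\<forall>i\<ge>n 1. coeff A i = 0) \<and> (\<forall>i\<ge>n 2. coeff B i = 0) \<and>
     (\<forall>j<N. form A B (monom 1 j) = 0) \<and> form A B (monom 1 N) = 1"
  proof -
    have "(\<forall>m. m 1 + m 2 = N \<longrightarrow> form A B (laguerre2_typeII \<alpha> c m) = 1) \<longleftrightarrow>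
        form A B (monom 1 N) = 1"
      if z: "\<forall>j<N. form A B (monom 1 j) = 0"
    proof
      assume *: "\<forall>m. m 1 + m 2 = N \<longrightarrow> form A B (laguerre2_typeII \<alpha> c m) = 1"
      \<comment> \<open>Some multi-index of total \<open>N\<close> is needed to make use of the
        universal condition; \<open>(N, 0)\<close> serves.\<close>
      define m :: "nat \<Rightarrow> nat" where "m = (\<lambda>k. if k = 1 then N else 0)"
      have "m 1 + m 2 = N" by (simp add: m_def)
      then show "form A B (monom 1 N) = 1"
        using * monic[OF z II] by metis
    next
      assume "form A B (monom 1 N) = 1"
      then show "\<forall>m. m 1 + m 2 = N \<longrightarrow> form A B (laguerre2_typeII \<alpha> c m) = 1"
        using monic[OF z II] by metis
    qed
    then show ?thesis by blast
  qed
  also have "\<dots> \<longleftrightarrow> (\<forall>i\<ge>n 1. coeff A i = 0) \<and> (\<forall>i\<ge>n 2. coeff B i = 0) \<and>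
     (\<forall>j\<le>N. form A B (monom 1 j) = (if j = N then 1 else 0))"
    by (auto simp: le_less)
  finally show ?thesis .
qed

text \<open>The explicit pair satisfies the defining conditions, and its difference from any other
  solution vanishes by \<open>form_eq_0_imp\<close>.\<close>

lemma laguerre2_typeI_eq:
  assumes "n 1 \<ge> 1" and "n 2 \<ge> 1" and "a \<in> {1, 2}"
  shows "laguerre2_typeI \<alpha> c n a = smult (1 / Gamma (\<alpha> + real (n 1) + real (n 2)))
           (typeI_poly \<alpha> (c a) (hat c a) (n a) (hat n a))"
proof -
  define r where "r = 1 / Gamma (\<alpha> + real (n 1) + real (n 2))"
  define A0 where "A0 = smult r (typeI_poly \<alpha> (c 1) (c 2) (n 1) (n 2))"
  define B0 where "B0 = smult r (typeI_poly \<alpha> (c 2) (c 1) (n 2) (n 1))"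
  obtain N where N: "n 1 + n 2 = Suc N" using assms by (cases "n 1 + n 2") auto
  have *: "is_laguerre2_typeI \<alpha> c n A0 B0"
    using typeI_poly_biorthogonal[OF \<alpha> c1 c2 c12, of _ "n 1" "n 2"]
    by (auto simp: is_laguerre2_typeI_iff[OF N] form_def A0_def B0_def coeff_typeI_poly r_def N
        simp del: One_nat_def)
  have "(THE A. is_laguerre2_typeI \<alpha> c n (fst A) (snd A)) = (A0, B0)"
  proof (rule the_equality)
    fix A assume A: "is_laguerre2_typeI \<alpha> c n (fst A) (snd A)"
    note A' = A[unfolded is_laguerre2_typeI_iff[OF N]]
      and AB0 = *[unfolded is_laguerre2_typeI_iff[OF N]]
    have "fst A - A0 = 0 \<and> snd A - B0 = 0"
    proof (rule form_eq_0_imp)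
      fix j assume "j < n 1 + n 2"
      then have "form (fst A) (snd A) (monom 1 j) = form A0 B0 (monom 1 j)"
        using A' AB0 N by simp
      moreover have "form (fst A - A0) (snd A - B0) p = form (fst A) (snd A) p - form A0 B0 p" for p
      proof -
        have "p * (fst A - A0) = p * fst A + smult (- 1) (p * A0)"
          "p * (snd A - B0) = p * snd A + smult (- 1) (p * B0)"
          by (simp_all add: algebra_simps)
        then show ?thesis unfolding form_def by (simp only: \<phi>_add \<phi>_smult \<psi>_add \<psi>_smult)
      qed
      ultimately show "form (fst A - A0) (snd A - B0) (monom 1 j) = 0" by simp
    qed (use A' AB0 in auto)
    then show "A = (A0, B0)" by (simp add: prod_eq_iff)
  qed (use * in simp)
  then show ?thesis
    using assms(3) by (auto simp: laguerre2_typeI_def hat_def A0_def B0_def r_def)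
qed

end

theorem proposition8p1:
  fixes \<alpha>0 :: real and c :: "nat \<Rightarrow> real" and n :: "nat \<Rightarrow> nat" and a :: nat and x :: real
  assumes "\<alpha>0 > -1" and "c 1 > 0" and "c 2 > 0" and "c 1 \<noteq> c 2"
    and "n 1 \<ge> 1" and "n 2 \<ge> 1" and "a \<in> {1, 2}"
  shows "poly (laguerre2_typeI \<alpha>0 c n a) x =
           laguerre2_K \<alpha>0 c n a *
           kampe_de_feriet [- real (n a) + 1, \<alpha>0 + 1] [] []
             [- real (n 1) - real (n 2) + 2] [\<alpha>0 + 1] []
             ((c a - hat c a) * c a / hat c a * x) ((hat c a - c a) / hat c a)
       \<and> laguerre2_K \<alpha>0 c n a *
           kampe_de_feriet [- real (n a) + 1, \<alpha>0 + 1] [] []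
             [- real (n 1) - real (n 2) + 2] [\<alpha>0 + 1] []
             ((c a - hat c a) * c a / hat c a * x) ((hat c a - c a) / hat c a) =
         laguerre2_K \<alpha>0 c n a *
           (\<Sum>l = 0..n a - 1. \<Sum>m = 0..n a - 1 - l.
              pochhammer (- real (n a) + 1) (l + m) * pochhammer (\<alpha>0 + 1) (l + m) /
              (fact l * fact m * pochhammer (- real (n 1) - real (n 2) + 2) (l + m) *
                 pochhammer (\<alpha>0 + 1) l) *
              ((c a - hat c a) * c a / hat c a) ^ l * ((hat c a - c a) / hat c a) ^ m * x ^ l)"
proof -
  \<comment> \<open>Naming the entries relative to \<open>a\<close> treats both values of
    \<open>a\<close> at once, and the successors remove the truncated subtractions.\<close>
  obtain N M where NM: "n a = Suc N" "hat n a = Suc M"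
    using assms(5-7) by (cases "n a"; cases "hat n a") (auto simp: hat_def)
  have sum: "n 1 + n 2 = Suc N + Suc M" "fact (n 1 - 1) * fact (n 2 - 1) = (fact N * fact M :: real)"
    using NM assms(7) by (auto simp: hat_def)
  have c: "c a > 0" "hat c a > 0" "c a \<noteq> hat c a"
    using assms(2-4,7) by (auto simp: hat_def)
  have par: "- real (n a) + 1 = - real N" "- real (n 1) - real (n 2) + 2 = - real (N + M)"
    "n a - 1 = N"
    using NM arg_cong[OF sum(1), of real] by simp_all
  have K: "laguerre2_K \<alpha>0 c n a = 1 / Gamma (\<alpha>0 + real (n 1) + real (n 2)) *
      ((- 1) ^ N * fact (N + M) / (fact N * fact M) * c a powr (\<alpha>0 + 1) *
       (c a * hat c a / (hat c a - c a)) ^ (N + M + 1))"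
    unfolding laguerre2_K_def sum par by simp
  have "poly (laguerre2_typeI \<alpha>0 c n a) x = laguerre2_K \<alpha>0 c n a *
      kdf_sum \<alpha>0 N M ((c a - hat c a) * c a / hat c a) ((hat c a - c a) / hat c a) x"
    unfolding laguerre2_typeI_eq[OF assms] NM poly_smult poly_typeI_poly[OF assms(1) c] K
    by (simp only: mult.assoc)
  then show ?thesis
    unfolding par kampe_de_feriet_eq_kdf_sum by (simp only: kdf_sum_eq_double_sum)
qed

end
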